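(* For every real $\alpha < 8$, infinitely many positive integers $k$ collapse for $\mathcal{C}_{\overline{\alpha}}$. For every real $\alpha \ge 8$, every positive integer $k$ is forcing for $\mathcal{C}_{\overline{\alpha}}$.
   Context: All graphs are finite and simple. For a graph $G$, a weighing is a function $w: E(G) \to \{-1,1\}$, and for a subgraph $H$, $w(H)=\sum_{e\in E(H)} w(e)$. For a positive integer $k$, $w$ is $k$-local positive if $w(H)>0$ for every connected subgraph $H$ of $G$ with exactly $k$ edges. Let $\mathcal{G}$ be an infinite family of connected graphs. $k$ is forcing for $\mathcal{G}$ if for all but finitely many $G \in \mathcal{G}$, every $k$-local positive weighing $w$ of $G$ satisfies $w(G)>0$. $k$ is weakly forcing for $\mathcal{G}$ if it is not forcing but there is a constant $C$ such that for all but finitely many $G\in\mathcal{G}$, every $k$-local positive weighing $w$ of $G$ has $w(G)\ge C$. $k$ collapses for $\mathcal{G}$ if it is neither forcing nor weakly forcing. $\mathcal{C}_{\overline{\alpha}}$ denotes the family of all connected graphs with average degree at least $\alpha$. *)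

theory Defs
  imports Complex_Main
begin

record 'a graph =
  verts :: "'a set"
  edges :: "'a set set"

definition simple_graph :: "'a graph \<Rightarrow> bool" where
  "simple_graph G \<longleftrightarrow>
     finite (verts G) \<and> (\<forall>e\<in>edges G. e \<subseteq> verts G \<and> card e = 2)"

definition subgraph :: "'a graph \<Rightarrow> 'a graph \<Rightarrow> bool" where
  "subgraph H G \<longleftrightarrow> simple_graph H \<and> verts H \<subseteq> verts G \<and> edges H \<subseteq> edges G"

definition adjacency :: "'a graph \<Rightarrow> 'a rel" where
  "adjacency G = {(u, v). {u, v} \<in> edges G}"

(* The null graph does not count as connected. *)
definition connected_graph :: "'a graph \<Rightarrow> bool" where
  "connected_graph G \<longleftrightarrow>
     verts G \<noteq> {} \<and> (\<forall>u\<in>verts G. \<forall>v\<in>verts G. (u, v) \<in> (adjacency G)\<^sup>*)"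

definition graph_iso :: "'a graph \<Rightarrow> 'b graph \<Rightarrow> bool" where
  "graph_iso G H \<longleftrightarrow>
     (\<exists>f. bij_betw f (verts G) (verts H) \<and> bij_betw ((`) f) (edges G) (edges H))"

definition vertex_degree :: "'a graph \<Rightarrow> 'a \<Rightarrow> nat" where
  "vertex_degree G v = card {e \<in> edges G. v \<in> e}"

definition average_degree :: "'a graph \<Rightarrow> real" where
  "average_degree G = (\<Sum>v\<in>verts G. real (vertex_degree G v)) / real (card (verts G))"

(* Values of a weighing outside the edge set are irrelevant. *)
definition weighing :: "'a graph \<Rightarrow> ('a set \<Rightarrow> int) \<Rightarrow> bool" where
  "weighing G w \<longleftrightarrow> (\<forall>e\<in>edges G. w e \<in> {-1, 1})"

definition weight :: "('a set \<Rightarrow> int) \<Rightarrow> 'a graph \<Rightarrow> int" where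
  "weight w H = (\<Sum>e\<in>edges H. w e)"

definition local_positive :: "nat \<Rightarrow> 'a graph \<Rightarrow> ('a set \<Rightarrow> int) \<Rightarrow> bool" where
  "local_positive k G w \<longleftrightarrow>
     (\<forall>H. subgraph H G \<and> connected_graph H \<and> card (edges H) = k \<longrightarrow> weight w H > 0)"

(* Every finite graph has a copy on vertices of type nat.  Graphs are counted up to
   isomorphism: a family closed under relabelling contains infinitely many copies of
   each of its members, so a literal count of exceptions would allow none at all. *)
definition almost_all :: "nat graph set \<Rightarrow> (nat graph \<Rightarrow> bool) \<Rightarrow> bool" where
  "almost_all \<G> P \<longleftrightarrow>
     (\<exists>\<X> :: nat graph set. finite \<X> \<and> (\<forall>G\<in>\<G>. (\<forall>X\<in>\<X>. \<not> graph_iso G X) \<longrightarrow> P G))"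

definition forcing :: "nat \<Rightarrow> nat graph set \<Rightarrow> bool" where
  "forcing k \<G> \<longleftrightarrow>
     almost_all \<G> (\<lambda>G. \<forall>w. weighing G w \<and> local_positive k G w \<longrightarrow> weight w G > 0)"

definition weakly_forcing :: "nat \<Rightarrow> nat graph set \<Rightarrow> bool" where
  "weakly_forcing k \<G> \<longleftrightarrow>
     \<not> forcing k \<G> \<and>
     (\<exists>C::real. almost_all \<G> (\<lambda>G. \<forall>w. weighing G w \<and> local_positive k G w
        \<longrightarrow> real_of_int (weight w G) \<ge> C))"

definition collapses :: "nat \<Rightarrow> nat graph set \<Rightarrow> bool" where
  "collapses k \<G> \<longleftrightarrow> \<not> forcing k \<G> \<and> \<not> weakly_forcing k \<G>"

definition avg_degree_family :: "real \<Rightarrow> nat graph set" where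
  "avg_degree_family \<alpha> =
     {G. simple_graph G \<and> connected_graph G \<and> average_degree G \<ge> \<alpha>}"

end

theory Submission
  imports Defs "HOL-Library.Nat_Bijection" "HOL-Library.Disjoint_Sets" "HOL-Library.Infinite_Set"
begin

text \<open>
  Let \<open>n\<close> be the number of vertices and \<open>N\<close> the set of negative edges. In a \<open>k\<close>-locally
  positive graph with at least \<open>k\<close> edges, a connected subgraph with at most \<open>k / 2\<close> positive
  edges has fewer than \<open>k / 2\<close> negative ones: otherwise grow it, or cut it down, to exactly \<open>k\<close>
  edges. Now partition the vertices into as few clusters as possible, where a cluster \<open>C\<close> is
  connected by its inner negative edges \<open>N[C]\<close> together with a set \<open>T\<close> of positive edges such
  that \<open>|T| < |C|\<close>, \<open>2 |T| \<le> |N[C]|\<close> and \<open>2 |N[C]| < k\<close>. Two clusters joined by an edge can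
  be merged if that edge is negative or if \<open>2 |T| + 2 \<le> |N[C]|\<close> for one of them. By minimality
  no negative edge leaves a cluster and \<open>|N[C]| \<le> 2 |T| + 1 < 2 |C|\<close> throughout, so
  \<open>|N| < 2 n\<close>. Average degree at least 8 means at least \<open>4 n\<close> edges, so the weight is positive.

  Below 8, hang many negative cliques on \<open>t\<close> vertices, each with \<open>2 L\<close> edges, on a positive
  clique by positive paths of length \<open>L + 1\<close>, and take \<open>k = 4 L + 1\<close>: a connected subgraph with
  \<open>k\<close> edges meets only one negative clique or contains two whole paths. When the positive clique
  balances the weight, the average degree is close to \<open>8 L / (L + t)\<close>, which tends to 8.
\<close>

section \<open>Connected subgraphs\<close>

lemma simple_graph_finite_edges: "simple_graph G \<Longrightarrow> finite (edges G)"
  by (rule finite_subset[of _ "Pow (verts G)"]) (auto simp: simple_graph_def)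

lemma simple_graph_edgeE:
  assumes "simple_graph G" "e \<in> edges G"
  obtains u v where "e = {u, v}" "u \<noteq> v" "u \<in> verts G" "v \<in> verts G"
proof -
  have "card e = 2" "e \<subseteq> verts G"
    using assms by (auto simp: simple_graph_def)
  then show thesis
    using that by (auto simp: card_2_iff)
qed

lemma adjacency_mono: "edges H \<subseteq> edges G \<Longrightarrow> (adjacency H)\<^sup>* \<subseteq> (adjacency G)\<^sup>*"
  by (rule rtrancl_mono) (auto simp: adjacency_def)

lemma adjacency_rtrancl_sym: "(u, v) \<in> (adjacency G)\<^sup>* \<Longrightarrow> (v, u) \<in> (adjacency G)\<^sup>*"
proof -
  have "sym (adjacency G)"
    by (auto simp: adjacency_def sym_def insert_commute)
  then show "(u, v) \<in> (adjacency G)\<^sup>* \<Longrightarrow> (v, u) \<in> (adjacency G)\<^sup>*"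
    by (meson sym_rtrancl symD)
qed

lemma connected_graphI:
  assumes "u \<in> verts G" "\<And>x. x \<in> verts G \<Longrightarrow> (u, x) \<in> (adjacency G)\<^sup>*"
  shows "connected_graph G"
  unfolding connected_graph_def
proof (intro conjI ballI)
  show "verts G \<noteq> {}"
    using assms by blast
  fix x y assume "x \<in> verts G" "y \<in> verts G"
  then show "(x, y) \<in> (adjacency G)\<^sup>*"
    using assms(2) adjacency_rtrancl_sym rtrancl_trans by metis
qed

text \<open>The two vertex sets may overlap. This lets the same lemma serve for merging two clusters
  and for adding an edge whose far end may or may not be a new vertex.\<close>

lemma connected_graph_join:
  assumes "connected_graph G" "connected_graph H" "u \<in> verts G" "v \<in> verts H"
    and K: "verts K = verts G \<union> verts H" "edges G \<subseteq> edges K" "edges H \<subseteq> edges K" "{u, v} \<in> edges K"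
  shows "connected_graph K"
proof (rule connected_graphI)
  show "u \<in> verts K"
    using assms by simp
  fix x assume x: "x \<in> verts K"
  have uv: "(u, v) \<in> (adjacency K)\<^sup>*"
    using K(4) by (auto simp: adjacency_def)
  show "(u, x) \<in> (adjacency K)\<^sup>*"
  proof (cases "x \<in> verts G")
    case True
    then have "(u, x) \<in> (adjacency G)\<^sup>*"
      using assms by (simp add: connected_graph_def)
    then show ?thesis
      using adjacency_mono[OF K(2)] by blast
  next
    case False
    then have "(v, x) \<in> (adjacency H)\<^sup>*"
      using assms x by (simp add: connected_graph_def)
    then have "(v, x) \<in> (adjacency K)\<^sup>*"
      using adjacency_mono[OF K(3)] by blast
    with uv show ?thesis
      by (rule rtrancl_trans)
  qed
qed

text \<open>A walk from \<open>x\<close> to \<open>y\<close> starts in \<open>S\<close> and ends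
  outside, so one of its steps leaves \<open>S\<close>.\<close>

lemma connected_graph_boundary_edge:
  assumes "connected_graph G" "x \<in> verts G" "x \<in> S" "y \<in> verts G" "y \<notin> S"
  obtains u v where "{u, v} \<in> edges G" "u \<in> S" "v \<notin> S"
proof -
  have "(x, y) \<in> (adjacency G)\<^sup>*"
    using assms by (simp add: connected_graph_def)
  then have "y \<notin> S \<longrightarrow> (\<exists>u v. {u, v} \<in> edges G \<and> u \<in> S \<and> v \<notin> S)"
    by (induction rule: rtrancl_induct) (use \<open>x \<in> S\<close> in \<open>auto simp: adjacency_def\<close>)
  with \<open>y \<notin> S\<close> that show thesis
    by blast
qed

text \<open>If \<open>H\<close> spans \<open>G\<close>, any missing edge can be added. Otherwise
  connectivity of \<open>G\<close> provides an edge that leaves the vertex set of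
  \<open>H\<close>.\<close>

lemma connected_subgraph_add_edge:
  assumes "connected_graph G" "simple_graph G" "connected_graph H" "subgraph H G"
    and less: "card (edges H) < card (edges G)"
  obtains K where "connected_graph K" "subgraph K G" "edges H \<subseteq> edges K"
    "card (edges K) = Suc (card (edges H))"
proof -
  have sub: "verts H \<subseteq> verts G" "edges H \<subseteq> edges G" "simple_graph H"
    using assms by (auto simp: subgraph_def)
  obtain u v where uv: "{u, v} \<in> edges G" "{u, v} \<notin> edges H" "u \<in> verts H" "v \<in> verts G"
  proof (cases "verts H = verts G")
    case True
    obtain e where "e \<in> edges G" "e \<notin> edges H"
      using less sub by (metis less_irrefl subset_antisym subsetI)
    then show ?thesis
      using that True simple_graph_edgeE[OF assms(2)] by metis
  next
    case False
    obtain x where "x \<in> verts H"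
      using assms by (auto simp: connected_graph_def)
    with False sub obtain y where "y \<in> verts G" "y \<notin> verts H"
      by auto
    then obtain u v where "{u, v} \<in> edges G" "u \<in> verts H" "v \<notin> verts H"
      using connected_graph_boundary_edge[OF assms(1)] \<open>x \<in> verts H\<close> sub by (metis subsetD)
    then show ?thesis
      using that sub assms(2) unfolding simple_graph_def by (metis insert_subset)
  qed
  define K where "K = \<lparr>verts = verts H \<union> {v}, edges = insert {u, v} (edges H)\<rparr>"
  have "connected_graph K"
    by (rule connected_graph_join[of H "\<lparr>verts = {v}, edges = {}\<rparr>" u v])
      (use assms uv in \<open>auto simp: K_def connected_graph_def\<close>)
  moreover have "card {u, v} = 2"
    using uv assms by (auto simp: simple_graph_def)
  then have "simple_graph K"
    using sub uv by (auto simp: K_def simple_graph_def)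
  then have "subgraph K G"
    using sub uv by (auto simp: K_def subgraph_def)
  moreover have "card (edges K) = Suc (card (edges H))"
    using uv simple_graph_finite_edges[OF sub(3)] by (simp add: K_def)
  ultimately show thesis
    using that[of K] by (auto simp: K_def)
qed

text \<open>Edges are added one at a time. Applied with a smaller ambient graph in place of
  \<open>G\<close>, this also cuts a large connected graph down to \<open>k\<close> edges.\<close>

lemma connected_subgraph_with_card:
  assumes "connected_graph G" "simple_graph G" "connected_graph H" "subgraph H G"
    and "card (edges H) \<le> k" "k \<le> card (edges G)"
  obtains K where "connected_graph K" "subgraph K G" "edges H \<subseteq> edges K" "card (edges K) = k"
proof -
  have "k \<le> card (edges G) \<longrightarrow>
      (\<exists>K. connected_graph K \<and> subgraph K G \<and> edges H \<subseteq> edges K \<and> card (edges K) = k)"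
    using \<open>card (edges H) \<le> k\<close>
  proof (induction k rule: dec_induct)
    case base
    then show ?case using assms by blast
  next
    case (step n)
    show ?case
    proof
      assume "Suc n \<le> card (edges G)"
      with step obtain K where K: "connected_graph K" "subgraph K G" "edges H \<subseteq> edges K" "card (edges K) = n"
        by auto
      moreover have "card (edges K) < card (edges G)"
        using K \<open>Suc n \<le> card (edges G)\<close> by simp
      ultimately obtain K' where "connected_graph K'" "subgraph K' G" "edges K \<subseteq> edges K'"
          "card (edges K') = Suc (card (edges K))"
        using connected_subgraph_add_edge[OF assms(1,2)] by metis
      with K show "\<exists>K. connected_graph K \<and> subgraph K G \<and> edges H \<subseteq> edges K \<and> card (edges K) = Suc n"
        by auto
    qed
  qed
  then show thesis
    using assms that by blast
qed

section \<open>Average degree at least 8\<close>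

definition negs :: "('a set \<Rightarrow> int) \<Rightarrow> 'a set set \<Rightarrow> 'a set set" where
  "negs w F = {e \<in> F. w e = -1}"

lemma weight_eq_card_negs:
  assumes "weighing G w" "finite (edges G)"
  shows "weight w G = int (card (edges G)) - 2 * int (card (negs w (edges G)))"
proof -
  have "weight w G = (\<Sum>e\<in>edges G. 1 - 2 * (if w e = -1 then 1 else 0))"
    using assms unfolding weight_def weighing_def by (intro sum.cong) auto
  also have "\<dots> = int (card (edges G)) - 2 * (\<Sum>e\<in>edges G. if w e = -1 then 1 else 0)"
    by (simp add: sum_subtractf sum_distrib_left)
  also have "(\<Sum>e\<in>edges G. if w e = -1 then 1 else 0) = int (card (negs w (edges G)))"
    using assms by (simp add: negs_def sum.If_cases Int_def)
  finally show ?thesis .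
qed

text \<open>Local positivity speaks only of exactly \<open>k\<close> edges; this transfers it to
  other sizes. A smaller \<open>H\<close> sits in a connected \<open>K\<close> with \<open>k\<close>
  edges, which has at least as many negative edges; a larger \<open>H\<close> contains such a
  \<open>K\<close>, which has at most as many positive ones.\<close>

lemma local_positive_few_negs:
  assumes "connected_graph G" "simple_graph G" "weighing G w" "local_positive k G w"
    and "k \<le> card (edges G)" "connected_graph H" "subgraph H G"
    and few: "2 * card (edges H - negs w (edges H)) \<le> k"
  shows "2 * card (negs w (edges H)) < k"
proof (rule ccontr)
  assume many: "\<not> ?thesis"
  have H: "simple_graph H" "finite (edges H)"
    using assms simple_graph_finite_edges by (auto simp: subgraph_def)
  have pos: "k > 2 * card (negs w (edges K))"
    if "connected_graph K" "subgraph K G" "card (edges K) = k" for K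
  proof -
    have "finite (edges K)"
      using that simple_graph_finite_edges by (auto simp: subgraph_def)
    moreover have "weighing K w"
      using that assms by (auto simp: weighing_def subgraph_def)
    moreover have "weight w K > 0"
      using that assms by (auto simp: local_positive_def)
    ultimately show ?thesis
      using that weight_eq_card_negs[of K w] by simp
  qed
  show False
  proof (cases "card (edges H) \<le> k")
    case True
    then obtain K where K: "connected_graph K" "subgraph K G" "edges H \<subseteq> edges K" "card (edges K) = k"
      using connected_subgraph_with_card[OF assms(1,2,6,7)] assms(5) by metis
    then have "finite (edges K)"
      using simple_graph_finite_edges by (auto simp: subgraph_def)
    then have "card (negs w (edges H)) \<le> card (negs w (edges K))"
      using K by (intro card_mono) (auto simp: negs_def)
    with pos[OF K(1,2,4)] many show False
      by linarith
  next
    case False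
    \<comment> \<open>Cutting down is done by growing a single vertex inside \<open>H\<close> to
      \<open>k\<close> edges. More than half of the edges of the resulting \<open>K\<close> are
      positive, which contradicts \<open>few\<close>.\<close>
    obtain x where "x \<in> verts H"
      using assms by (auto simp: connected_graph_def)
    then have "connected_graph \<lparr>verts = {x}, edges = {}\<rparr>" "subgraph \<lparr>verts = {x}, edges = {}\<rparr> H"
      by (auto simp: connected_graph_def subgraph_def simple_graph_def)
    then obtain K where K: "connected_graph K" "subgraph K H" "card (edges K) = k"
      by (rule connected_subgraph_with_card[OF assms(6) H(1), where k = k]) (use False in auto)
    then have sub: "edges K \<subseteq> edges H" "subgraph K G" "finite (edges K)"
      using assms simple_graph_finite_edges by (auto simp: subgraph_def)
    then have "card (edges K - negs w (edges K)) \<le> card (edges H - negs w (edges H))"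
      using H by (intro card_mono) (auto simp: negs_def)
    moreover have "card (edges K) = card (edges K - negs w (edges K)) + card (negs w (edges K))"
      using sub by (subst card_Un_disjoint[symmetric]) (auto simp: negs_def intro!: arg_cong[where f = card])
    ultimately show False
      using pos[OF K(1) sub(2) K(3)] K(3) few by linarith
  qed
qed

section \<open>Clusters and a minimal partition into clusters\<close>

definition inner_negs :: "'a graph \<Rightarrow> ('a set \<Rightarrow> int) \<Rightarrow> 'a set \<Rightarrow> 'a set set" where
  "inner_negs G w C = {e \<in> edges G. e \<subseteq> C \<and> w e = -1}"

text \<open>The last two inequalities keep the number of positive edges low enough for
  \<open>local_positive_few_negs\<close> after a merge. The bound \<open>card T < card C\<close>
  turns \<open>card (inner_negs G w C) < 2 * card T + 2\<close> into a bound linear in the number of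
  vertices.\<close>

definition cluster :: "nat \<Rightarrow> 'a graph \<Rightarrow> ('a set \<Rightarrow> int) \<Rightarrow> 'a set \<Rightarrow> 'a set set \<Rightarrow> bool" where
  "cluster k G w C T \<longleftrightarrow>
     C \<subseteq> verts G \<and> T \<subseteq> edges G \<and> (\<forall>e\<in>T. e \<subseteq> C \<and> w e \<noteq> -1) \<and>
     connected_graph \<lparr>verts = C, edges = inner_negs G w C \<union> T\<rparr> \<and>
     card T < card C \<and> 2 * card T \<le> card (inner_negs G w C) \<and> 2 * card (inner_negs G w C) < k"

lemma cluster_singleton:
  assumes "simple_graph G" "x \<in> verts G" "k > 0"
  shows "cluster k G w {x} {}"
proof -
  have "\<not> e \<subseteq> {x}" if "e \<in> edges G" for e
    by (rule simple_graph_edgeE[OF assms(1) that]) auto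
  then have "inner_negs G w {x} = {}"
    by (auto simp: inner_negs_def)
  then show ?thesis
    using assms by (auto simp: cluster_def connected_graph_def)
qed

text \<open>The joining edge costs a positive edge only if it is positive, and then the slack in
  \<open>C\<close> pays for it. The bound by \<open>k\<close> does not follow by addition, since
  further negative edges may run between \<open>C\<close> and \<open>C'\<close>; it comes from
  \<open>local_positive_few_negs\<close>.\<close>

lemma cluster_merge:
  assumes G: "connected_graph G" "simple_graph G" "weighing G w" "local_positive k G w"
    "k \<le> card (edges G)"
    and C: "cluster k G w C T" and C': "cluster k G w C' T'" and disj: "C \<inter> C' = {}"
    and e: "u \<in> C" "v \<in> C'" "{u, v} \<in> edges G"
    and slack: "w {u, v} = -1 \<or> 2 * card T + 2 \<le> card (inner_negs G w C)"
  shows "\<exists>T. cluster k G w (C \<union> C') T"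
proof -
  define U where "U = T \<union> T' \<union> (if w {u, v} = -1 then {} else {{u, v}})"
  have fin: "finite (edges G)" "finite (verts G)"
    using G simple_graph_finite_edges by (auto simp: simple_graph_def)
  have finC: "finite C" "finite C'" "finite T" "finite T'"
    using fin C C' finite_subset by (auto simp: cluster_def)
  have finN: "finite (inner_negs G w A)" for A
    using fin by (auto simp: inner_negs_def)
  let ?H = "\<lparr>verts = C \<union> C', edges = inner_negs G w (C \<union> C') \<union> U\<rparr>"
  have conn: "connected_graph ?H"
    by (rule connected_graph_join[of "\<lparr>verts = C, edges = inner_negs G w C \<union> T\<rparr>"
          "\<lparr>verts = C', edges = inner_negs G w C' \<union> T'\<rparr>" u v])
      (use C C' e in \<open>auto simp: cluster_def U_def inner_negs_def\<close>)
  have UG: "U \<subseteq> edges G" "\<forall>e\<in>U. e \<subseteq> C \<union> C' \<and> w e \<noteq> -1"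
    using C C' e by (auto simp: U_def cluster_def)
  then have sub: "subgraph ?H G"
    using G C C' finC by (auto simp: subgraph_def simple_graph_def cluster_def inner_negs_def)
  \<comment> \<open>An empty edge would lie inside both clusters, so it has to be excluded before
    the inner edge sets are disjoint.\<close>
  have "e \<noteq> {}" if "e \<in> edges G" for e
    using G that by (auto simp: simple_graph_def)
  then have "inner_negs G w C \<inter> inner_negs G w C' = {}"
    using disj by (fastforce simp: inner_negs_def)
  then have "card (inner_negs G w C) + card (inner_negs G w C') = card (inner_negs G w C \<union> inner_negs G w C')"
    using finN by (simp add: card_Un_disjoint)
  also have "\<dots> \<le> card (inner_negs G w (C \<union> C'))"
    using finN by (intro card_mono) (auto simp: inner_negs_def)
  finally have negs: "card (inner_negs G w C) + card (inner_negs G w C') \<le> card (inner_negs G w (C \<union> C'))" .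
  have "card U \<le> card (T \<union> T') + card (if w {u, v} = -1 then {} else {{u, v}})"
    unfolding U_def by (rule card_Un_le)
  also have "\<dots> \<le> card T + card T' + (if w {u, v} = -1 then 0 else 1)"
    using card_Un_le[of T T'] by auto
  finally have U: "card U \<le> card T + card T' + (if w {u, v} = -1 then 0 else 1)" .
  \<comment> \<open>Both numbers on the right are below \<open>k / 2\<close>, so
    \<open>2 * card U\<close> is below \<open>k\<close>.\<close>
  then have U2: "2 * card U \<le> card (inner_negs G w C) + card (inner_negs G w C')"
    using slack C C' by (auto simp: cluster_def split: if_splits)
  have "card C + card C' = card (C \<union> C')"
    using finC disj by (simp add: card_Un_disjoint)
  \<comment> \<open>Both old inequalities are strict, which leaves room for the one extra
    edge.\<close>
  then have UC: "card U < card (C \<union> C')"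
    using U C C' by (auto simp: cluster_def split: if_splits)
  have "negs w (edges ?H) = inner_negs G w (C \<union> C')" "edges ?H - negs w (edges ?H) = U"
    using UG by (auto simp: negs_def inner_negs_def)
  then have "2 * card (inner_negs G w (C \<union> C')) < k"
    using local_positive_few_negs[OF G conn sub] U2 C C' by (simp add: cluster_def)
  then have "cluster k G w (C \<union> C') U"
    unfolding cluster_def using UG conn UC U2 negs C C' by (auto simp: cluster_def)
  then show ?thesis ..
qed

lemma local_positive_card_negs_less:
  assumes G: "connected_graph G" "simple_graph G" "weighing G w" "local_positive k G w"
    "k \<le> card (edges G)" and k: "0 < k" "k \<le> card (verts G)"
  shows "card (negs w (edges G)) < 2 * card (verts G)"
proof -
  define good where "good P \<longleftrightarrow> partition_on (verts G) P \<and> (\<forall>C\<in>P. \<exists>T. cluster k G w C T)" for P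
  have fin: "finite (edges G)" "finite (verts G)"
    using G simple_graph_finite_edges by (auto simp: simple_graph_def)
  \<comment> \<open>The partition into singletons shows that a good partition of least size
    exists.\<close>
  have "good ((\<lambda>x. {x}) ` verts G)"
    using cluster_singleton[OF G(2) _ k(1)] by (auto simp: good_def partition_on_def disjoint_def)
  then obtain P where P: "good P" and min: "\<And>Q. good Q \<Longrightarrow> card P \<le> card Q"
    using arg_min_natI[of good _ card] arg_min_nat_le[of good _ card] by metis
  have part: "partition_on (verts G) P"
    using P by (simp add: good_def)
  then have finP: "finite P"
    using fin finite_elements by blast
  \<comment> \<open>An edge violating this would permit a merge, giving a good partition with one
    cluster fewer.\<close>
  have sat: "w {u, v} \<noteq> -1 \<and> card (inner_negs G w C) < 2 * card T + 2"
    if uv: "C \<in> P" "cluster k G w C T" "u \<in> C" "v \<notin> C" "{u, v} \<in> edges G" for C T u v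
  proof (rule ccontr)
    assume "\<not> ?thesis"
    then have slack: "w {u, v} = -1 \<or> 2 * card T + 2 \<le> card (inner_negs G w C)"
      by auto
    have "v \<in> verts G"
      using uv G by (auto simp: simple_graph_def)
    then obtain C' where C': "C' \<in> P" "v \<in> C'"
      using part by (auto simp: partition_on_def)
    then have disj: "C \<inter> C' = {}" "C \<noteq> C'"
      using part uv by (auto simp: partition_on_def disjoint_def)
    obtain T' where "cluster k G w C' T'"
      using P C' by (auto simp: good_def)
    then obtain U where "cluster k G w (C \<union> C') U"
      using cluster_merge[OF G uv(2) _ disj(1) uv(3) C'(2) uv(5) slack] by blast
    moreover define Q where "Q = insert (C \<union> C') (P - {C, C'})"
    moreover have "partition_on (verts G) Q"
      using part uv(1) C' disj unfolding partition_on_def disjoint_def Q_def by auto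
    ultimately have "good Q"
      using P by (auto simp: good_def)
    have "card Q \<le> Suc (card (P - {C, C'}))"
      unfolding Q_def by (simp add: card_insert_if finP)
    also have "card (P - {C, C'}) = card P - 2"
      using uv C' disj by (subst card_Diff_subset) auto
    also have "card {C, C'} \<le> card P"
      using uv C' finP by (intro card_mono) auto
    then have "Suc (card P - 2) < card P"
      using disj by simp
    finally show False
      using min[OF \<open>good Q\<close>] by simp
  qed
  show ?thesis
  \<comment> \<open>A single cluster has no outgoing edge, so \<open>sat\<close> says nothing about
    it. Its own bound by \<open>k / 2\<close> suffices because \<open>k\<close> is at most the
    number of vertices.\<close>
  proof (cases "verts G \<in> P")
    case True
    then obtain T where "cluster k G w (verts G) T"
      using P by (auto simp: good_def)
    moreover have "inner_negs G w (verts G) = negs w (edges G)"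
      using G by (auto simp: inner_negs_def negs_def simple_graph_def)
    ultimately show ?thesis
      using k by (auto simp: cluster_def)
  next
    case False
    \<comment> \<open>By connectivity some edge leaves \<open>C\<close>, so \<open>sat\<close>
      applies: at most \<open>2 * card T + 1\<close> negative edges lie inside, and
      \<open>card T\<close> is at most \<open>card C - 1\<close>.\<close>
    have small: "card (inner_negs G w C) < 2 * card C" if C: "C \<in> P" for C
    proof -
      obtain T where T: "cluster k G w C T"
        using P C by (auto simp: good_def)
      obtain x where "x \<in> C"
        using part C by (metis ex_in_conv partition_on_def)
      moreover have "C \<subseteq> verts G" "C \<noteq> verts G"
        using part C False by (auto simp: partition_on_def)
      ultimately obtain u v where "{u, v} \<in> edges G" "u \<in> C" "v \<notin> C"
        using connected_graph_boundary_edge[OF G(1), of x C] by blast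
      then show ?thesis
        using sat[OF C T] T by (fastforce simp: cluster_def)
    qed
    have "negs w (edges G) \<subseteq> (\<Union>C\<in>P. inner_negs G w C)"
    proof
      fix e assume e: "e \<in> negs w (edges G)"
      then obtain u v where uv: "e = {u, v}" "u \<in> verts G"
        using simple_graph_edgeE[OF G(2)] by (metis (mono_tags, lifting) mem_Collect_eq negs_def)
      then obtain C where C: "C \<in> P" "u \<in> C"
        using part by (auto simp: partition_on_def)
      moreover obtain T where "cluster k G w C T"
        using P C by (auto simp: good_def)
      ultimately have "v \<in> C"
        using sat e uv by (auto simp: negs_def)
      then show "e \<in> (\<Union>C\<in>P. inner_negs G w C)"
        using C uv e by (auto simp: inner_negs_def negs_def)
    qed
    then have "card (negs w (edges G)) \<le> card (\<Union>C\<in>P. inner_negs G w C)"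
      using finP fin by (intro card_mono) (auto simp: inner_negs_def)
    also have "\<dots> \<le> (\<Sum>C\<in>P. card (inner_negs G w C))"
      using finP by (rule card_UN_le)
    also have "\<dots> < (\<Sum>C\<in>P. 2 * card C)"
    proof (rule sum_strict_mono)
      show "P \<noteq> {}"
        using part k by (auto simp: partition_on_def)
    qed (use finP small in auto)
    also have "\<dots> = 2 * card (\<Union>P)"
    proof -
      have "pairwise disjnt P"
        using part by (auto simp: partition_on_def disjoint_def pairwise_def disjnt_def)
      moreover have "finite C" if "C \<in> P" for C
        using that part fin(2) by (metis Union_upper finite_subset partition_on_def)
      ultimately show ?thesis
        by (simp add: card_Union_disjoint sum_distrib_left)
    qed
    also have "\<Union>P = verts G"
      using part by (simp add: partition_on_def)
    finally show ?thesis .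
  qed
qed

section \<open>Degree sum and the finitely many small exceptions\<close>

lemma average_degree_eq:
  assumes "simple_graph G"
  shows "average_degree G = 2 * real (card (edges G)) / real (card (verts G))"
proof -
  have "card {v \<in> verts G. v \<in> e} = 2" if "e \<in> edges G" for e
    using assms that by (metis (no_types, lifting) Collect_mem_eq Collect_cong simple_graph_def subsetD)
  then have "(\<Sum>v\<in>verts G. card {e \<in> edges G. v \<in> e}) = 2 * card (edges G)"
    using assms simple_graph_finite_edges[OF assms]
    by (intro sum_multicount) (auto simp: simple_graph_def)
  then have "(\<Sum>v\<in>verts G. real (vertex_degree G v)) = 2 * real (card (edges G))"
    unfolding vertex_degree_def by (metis of_nat_mult of_nat_numeral of_nat_sum)
  then show ?thesis
    by (simp add: average_degree_def)
qed

text \<open>Numbering the vertices from 0 embeds every such graph in the range below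
  \<open>k\<close>, where only finitely many graphs live. These serve as the exceptions in the
  definition of forcing.\<close>

lemma finite_small_graph_representatives:
  obtains X :: "nat graph set" where "finite X"
    "\<And>G :: 'a graph. simple_graph G \<Longrightarrow> card (verts G) < k \<Longrightarrow> \<exists>H\<in>X. graph_iso G H"
proof
  let ?X = "(\<lambda>(V, E). \<lparr>verts = V, edges = E\<rparr>) ` (Pow {..<k} \<times> Pow (Pow {..<k}))"
  show "finite ?X"
    by simp
  fix G :: "'a graph" assume G: "simple_graph G" "card (verts G) < k"
  then obtain f where f: "bij_betw f (verts G) {0..<card (verts G)}"
    using ex_bij_betw_finite_nat by (metis simple_graph_def)
  let ?H = "\<lparr>verts = f ` verts G, edges = (`) f ` edges G\<rparr>"
  have E: "edges G \<subseteq> Pow (verts G)"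
    using G by (auto simp: simple_graph_def)
  have "bij_betw f (verts G) (verts ?H)"
    using f by (simp add: bij_betw_def)
  moreover have "inj_on ((`) f) (edges G)"
    using f E inj_on_image_Pow inj_on_subset by (metis bij_betw_def)
  then have "bij_betw ((`) f) (edges G) (edges ?H)"
    by (simp add: bij_betw_def)
  ultimately have "graph_iso G ?H"
    by (auto simp: graph_iso_def)
  moreover have "f ` verts G \<subseteq> {..<k}"
    using f G by (auto simp: bij_betw_def)
  then have "?H \<in> ?X"
    using E by (intro image_eqI[where x = "(f ` verts G, (`) f ` edges G)"]) auto
  ultimately show "\<exists>H\<in>?X. graph_iso G H"
    by blast
qed

lemma forcing_avg_degree_family:
  assumes "\<alpha> \<ge> 8" "k > 0"
  shows "forcing k (avg_degree_family \<alpha>)"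
proof -
  obtain X :: "nat graph set" where X: "finite X"
    "\<And>G :: nat graph. simple_graph G \<Longrightarrow> card (verts G) < k \<Longrightarrow> \<exists>H\<in>X. graph_iso G H"
    using finite_small_graph_representatives[where ?'a = nat] by metis
  have "weight w G > 0"
    if G: "G \<in> avg_degree_family \<alpha>" "\<forall>H\<in>X. \<not> graph_iso G H" "weighing G w" "local_positive k G w" for G w
  proof -
    have fam: "simple_graph G" "connected_graph G" "average_degree G \<ge> 8"
      using G assms by (auto simp: avg_degree_family_def)
    have n: "k \<le> card (verts G)"
      using X(2) fam G(2) by (meson not_le)
    have "8 * real (card (verts G)) \<le> 2 * real (card (edges G))"
      using fam n assms average_degree_eq[OF fam(1)] by (simp add: field_simps)
    then have e: "4 * card (verts G) \<le> card (edges G)"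
      by linarith
    then have "card (negs w (edges G)) < 2 * card (verts G)"
      using local_positive_card_negs_less[OF fam(2,1) G(3,4)] n assms by simp
    then show ?thesis
      using e weight_eq_card_negs[OF G(3) simple_graph_finite_edges[OF fam(1)]] by simp
  qed
  then show ?thesis
    unfolding forcing_def almost_all_def using X(1) by blast
qed

section \<open>Average degree below 8\<close>

lemma weight_ge_neg_card:
  assumes "weighing G w"
  shows "weight w G \<ge> - int (card (edges G))"
proof -
  have "- 1 \<le> w e" if "e \<in> edges G" for e
  proof -
    have "w e = - 1 \<or> w e = 1"
      using assms that by (simp add: weighing_def)
    then show ?thesis
      by linarith
  qed
  then show ?thesis
    using sum_mono[of "edges G" "\<lambda>_. - 1" w] by (simp add: weight_def)
qed

text \<open>A graph of weight below \<open>- M\<close> has more than \<open>M\<close> edges. Hence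
  sufficiently negative examples avoid any finite list of exceptions up to isomorphism, while
  violating both positivity and any proposed constant \<open>C\<close>.\<close>

lemma collapsesI:
  assumes unbounded: "\<And>D::nat. \<exists>G\<in>\<G>. \<exists>w. weighing G w \<and> local_positive k G w \<and> weight w G \<le> - int D"
  shows "collapses k \<G>"
proof -
  have bad: "\<exists>G\<in>\<G>. (\<forall>H\<in>X. \<not> graph_iso G H) \<and>
      (\<exists>w. weighing G w \<and> local_positive k G w \<and> real_of_int (weight w G) < C \<and> weight w G \<le> 0)"
    if X: "finite X" for X :: "nat graph set" and C :: real
  proof -
    \<comment> \<open>The inserted 0 covers the case of an empty list of exceptions.\<close>
    define M where "M = Max (insert 0 ((\<lambda>H. card (edges H)) ` X))"
    have M: "card (edges H) \<le> M" if "H \<in> X" for H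
      unfolding M_def using X that by (intro Max_ge) auto
    obtain G w where G: "G \<in> \<G>" "weighing G w" "local_positive k G w"
      "weight w G \<le> - int (M + 1 + nat \<lceil>\<bar>C\<bar>\<rceil>)"
      using unbounded[of "M + 1 + nat \<lceil>\<bar>C\<bar>\<rceil>"] by blast
    have "\<not> graph_iso G H" if "H \<in> X" for H
    proof
      assume "graph_iso G H"
      then have "card (edges G) = card (edges H)"
        by (auto simp: graph_iso_def dest: bij_betw_same_card)
      then show False
        using M[OF that] weight_ge_neg_card[OF G(2)] G(4) by linarith
    qed
    moreover have "real_of_int (weight w G) < C"
      using G(4) by linarith
    moreover have "weight w G \<le> 0"
      using G(4) by linarith
    ultimately show ?thesis
      using G by blast
  qed
  have "\<not> forcing k \<G>"
    unfolding forcing_def almost_all_def using bad by (metis not_less)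
  moreover have "\<not> weakly_forcing k \<G>"
    unfolding weakly_forcing_def almost_all_def using bad by (metis not_less)
  ultimately show ?thesis
    by (simp add: collapses_def)
qed

section \<open>Flower graphs: size and weight\<close>

definition vtx :: "nat \<Rightarrow> nat \<Rightarrow> nat" where
  "vtx i j = prod_encode (i, j)"

lemma vtx_eq_iff [simp]: "vtx i j = vtx i' j' \<longleftrightarrow> i = i' \<and> j = j'"
  by (simp add: vtx_def prod_encode_eq)

lemma inj_on_vtx: "inj_on (vtx i) A"
  by (simp add: inj_on_def)

definition pairs :: "'a set \<Rightarrow> 'a set set" where
  "pairs A = {e. e \<subseteq> A \<and> card e = 2}"

lemma card_pairs: "finite A \<Longrightarrow> card (pairs A) = card A choose 2"
  by (simp add: pairs_def n_subsets)

lemma finite_pairs: "finite A \<Longrightarrow> finite (pairs A)"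
  by (simp add: pairs_def)

lemma doubleton_in_pairs [simp]: "{u, v} \<in> pairs A \<longleftrightarrow> u \<in> A \<and> v \<in> A \<and> u \<noteq> v"
  by (auto simp: pairs_def card_2_iff doubleton_eq_iff)

text \<open>
  The vertices \<open>vtx 0 j\<close> form the positive clique. The \<open>i\<close>-th path, for \<open>i > 0\<close>, starts at
  \<open>vtx 0 0\<close> and runs through \<open>vtx i 0, \<dots>, vtx i L\<close>; the \<open>i\<close>-th negative clique is
  \<open>blob L t i\<close> and contains the end \<open>vtx i L\<close> of that path.
\<close>

definition path_edge :: "nat \<Rightarrow> nat \<Rightarrow> nat set" where
  "path_edge i j = {if j = 0 then vtx 0 0 else vtx i (j - 1), vtx i j}"

definition blob :: "nat \<Rightarrow> nat \<Rightarrow> nat \<Rightarrow> nat set" where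
  "blob L t i = vtx i ` {L..<L + t}"

definition core :: "nat \<Rightarrow> nat set" where
  "core s = vtx 0 ` {..<s}"

definition flower :: "nat \<Rightarrow> nat \<Rightarrow> nat \<Rightarrow> nat \<Rightarrow> nat graph" where
  "flower L t s m =
     \<lparr>verts = core s \<union> (\<Union>i\<in>{1..m}. vtx i ` {..<L + t}),
      edges = pairs (core s) \<union> (\<Union>i\<in>{1..m}. path_edge i ` {..L}) \<union> (\<Union>i\<in>{1..m}. pairs (blob L t i))\<rparr>"

definition flower_weight :: "nat \<Rightarrow> nat \<Rightarrow> nat \<Rightarrow> nat set \<Rightarrow> int" where
  "flower_weight L t m e = (if e \<in> (\<Union>i\<in>{1..m}. pairs (blob L t i)) then -1 else 1)"

lemma weighing_flower: "weighing G (flower_weight L t m)"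
  by (simp add: weighing_def flower_weight_def)

lemma path_edge_eq_iff:
  assumes "i > 0" "i' > 0"
  shows "path_edge i j = path_edge i' j' \<longleftrightarrow> i = i' \<and> j = j'"
  using assms by (auto simp: path_edge_def doubleton_eq_iff split: if_splits)

lemma path_edge_not_in_blob:
  assumes "i > 0" "i' > 0" "j \<le> L"
  shows "path_edge i j \<notin> pairs (blob L t i')"
  using assms by (auto simp: path_edge_def blob_def)

lemma path_edge_not_in_core:
  assumes "i > 0"
  shows "path_edge i j \<notin> pairs (core s)"
  using assms by (auto simp: path_edge_def core_def)

lemma card_path_edges:
  assumes "0 \<notin> I" "finite I"
  shows "card (\<Union>i\<in>I. path_edge i ` {..L}) = card I * (L + 1)"
proof -
  have "(\<Union>i\<in>I. path_edge i ` {..L}) = case_prod path_edge ` (I \<times> {..L})"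
    by auto
  moreover have "inj_on (case_prod path_edge) (I \<times> {..L})"
    using assms by (auto simp: inj_on_def) (metis gr0I path_edge_eq_iff)+
  ultimately show ?thesis
    by (simp add: card_image card_cartesian_product)
qed

lemma blob_pairs_disjoint:
  assumes "e \<in> pairs (blob L t i)" "e \<in> pairs (blob L t i')"
  shows "i = i'"
proof -
  obtain x where "x \<in> e"
    using assms by (fastforce simp: pairs_def)
  then have "x \<in> blob L t i" "x \<in> blob L t i'"
    using assms by (auto simp: pairs_def)
  then show ?thesis
    by (auto simp: blob_def)
qed

lemma card_blob_pairs: "card (\<Union>i\<in>{1..m}. pairs (blob L t i)) = m * (t choose 2)"
proof -
  have "card (\<Union>i\<in>{1..m}. pairs (blob L t i)) = (\<Sum>i\<in>{1..m}. card (pairs (blob L t i)))"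
    by (rule card_UN_disjoint) (auto simp: blob_def finite_pairs dest: blob_pairs_disjoint[unfolded blob_def])
  also have "\<dots> = m * (t choose 2)"
    by (simp add: card_pairs blob_def card_image[OF inj_on_vtx])
  finally show ?thesis .
qed

lemma card_verts_flower: "card (verts (flower L t s m)) = s + m * (L + t)"
proof -
  have "card (\<Union>i\<in>{1..m}. vtx i ` {..<L + t}) = (\<Sum>i\<in>{1..m}. card (vtx i ` {..<L + t}))"
    by (rule card_UN_disjoint) auto
  also have "\<dots> = m * (L + t)"
    by (simp add: card_image[OF inj_on_vtx])
  finally have "card (\<Union>i\<in>{1..m}. vtx i ` {..<L + t}) = m * (L + t)" .
  moreover have "card (core s) = s"
    by (simp add: core_def card_image[OF inj_on_vtx])
  moreover have "card (core s \<union> (\<Union>i\<in>{1..m}. vtx i ` {..<L + t})) =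
      card (core s) + card (\<Union>i\<in>{1..m}. vtx i ` {..<L + t})"
    by (rule card_Un_disjoint) (auto simp: core_def)
  ultimately show ?thesis
    by (simp add: flower_def)
qed

lemma simple_graph_flower:
  assumes "s > 0" "t > 0"
  shows "simple_graph (flower L t s m)"
  unfolding simple_graph_def
proof (intro conjI ballI)
  show "finite (verts (flower L t s m))"
    by (simp add: flower_def core_def)
  fix e assume "e \<in> edges (flower L t s m)"
  then consider "e \<in> pairs (core s)" | i j where "i \<in> {1..m}" "j \<le> L" "e = path_edge i j"
    | i where "i \<in> {1..m}" "e \<in> pairs (blob L t i)"
    by (auto simp: flower_def)
  then have "e \<subseteq> verts (flower L t s m) \<and> card e = 2"
  proof cases
    case 1
    then show ?thesis by (auto simp: pairs_def flower_def)
  next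
    case 2
    then have "vtx i (j - 1) \<in> vtx i ` {..<L + t}" "vtx i j \<in> vtx i ` {..<L + t}" "vtx 0 0 \<in> core s"
      using assms by (auto simp: core_def)
    then have "e \<subseteq> verts (flower L t s m)"
      using 2 by (auto simp: path_edge_def flower_def)
    moreover have "card e = 2"
      using 2 by (auto simp: path_edge_def)
    ultimately show ?thesis ..
  next
    case 3
    then have "blob L t i \<subseteq> verts (flower L t s m)"
      by (force simp: blob_def flower_def)
    with 3 show ?thesis by (auto simp: pairs_def)
  qed
  then show "e \<subseteq> verts (flower L t s m)" "card e = 2"
    by auto
qed

lemma card_edges_flower:
  "card (edges (flower L t s m)) = (s choose 2) + m * (L + 1) + m * (t choose 2)"
proof -
  let ?A = "pairs (core s)" and ?B = "\<Union>i\<in>{1..m}. path_edge i ` {..L}" and ?C = "\<Union>i\<in>{1..m}. pairs (blob L t i)"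
  have fin: "finite ?A" "finite ?B" "finite ?C"
    by (auto simp: core_def blob_def intro!: finite_pairs)
  have "e \<noteq> {}" if "e \<in> pairs A" for e :: "nat set" and A
    using that by (auto simp: pairs_def)
  then have "?A \<inter> ?C = {}"
    by (fastforce simp: pairs_def core_def blob_def)
  moreover have "?A \<inter> ?B = {}"
    using path_edge_not_in_core by fastforce
  moreover have "?B \<inter> ?C = {}"
    using path_edge_not_in_blob by fastforce
  ultimately have "card (?A \<union> ?B \<union> ?C) = card ?A + card ?B + card ?C"
    using fin by (subst card_Un_disjoint, blast, blast, blast, subst card_Un_disjoint) auto
  moreover have "card ?A = s choose 2"
    by (simp add: card_pairs core_def card_image[OF inj_on_vtx])
  moreover have "card ?B = m * (L + 1)"
    using card_path_edges[of "{1..m}" L] by simp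
  ultimately show ?thesis
    using card_blob_pairs[of L t m] by (simp add: flower_def)
qed

lemma negs_flower: "negs (flower_weight L t m) (edges (flower L t s m)) = (\<Union>i\<in>{1..m}. pairs (blob L t i))"
  by (auto simp: negs_def flower_def flower_weight_def)

lemma weight_flower:
  assumes "s > 0" "t > 0"
  shows "weight (flower_weight L t m) (flower L t s m) =
    int (s choose 2) + int (m * (L + 1)) - int (m * (t choose 2))"
  using weight_eq_card_negs[OF weighing_flower simple_graph_finite_edges[OF simple_graph_flower[OF assms]]]
  by (simp add: negs_flower card_blob_pairs[simplified] card_edges_flower)

section \<open>Connectivity and local positivity of flower graphs\<close>

lemma connected_flower:
  assumes "s > 0" "t > 0"
  shows "connected_graph (flower L t s m)"
proof (rule connected_graphI)
  let ?R = "adjacency (flower L t s m)"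
  show "vtx 0 0 \<in> verts (flower L t s m)"
    using assms by (auto simp: flower_def core_def)
  have path: "(vtx 0 0, vtx i j) \<in> ?R\<^sup>*" if i: "i \<in> {1..m}" and "j \<le> L" for i j
    using \<open>j \<le> L\<close>
  proof (induction j)
    case 0
    have "path_edge i 0 \<in> edges (flower L t s m)"
      using i by (auto simp: flower_def)
    then show ?case
      by (auto simp: path_edge_def adjacency_def)
  next
    case (Suc j)
    then have "path_edge i (Suc j) \<in> edges (flower L t s m)"
      using i by (auto simp: flower_def)
    then have "(vtx i j, vtx i (Suc j)) \<in> ?R"
      by (auto simp: path_edge_def adjacency_def)
    with Suc show ?case
      by (meson Suc_leD rtrancl.rtrancl_into_rtrancl)
  qed
  fix x assume "x \<in> verts (flower L t s m)"
  then consider j where "x = vtx 0 j" "j < s" | i j where "i \<in> {1..m}" "x = vtx i j" "j < L + t"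
    by (auto simp: flower_def core_def)
  then show "(vtx 0 0, x) \<in> ?R\<^sup>*"
  proof cases
    case 1
    then have "(vtx 0 0, x) \<in> ?R" if "j \<noteq> 0"
      using that assms by (auto simp: adjacency_def flower_def core_def)
    with 1 show ?thesis
      by (cases "j = 0") auto
  next
    case 2
    show ?thesis
    proof (cases "j \<le> L")
      case True
      with path 2 show ?thesis by simp
    next
      case False
      then have "{vtx i L, vtx i j} \<in> pairs (blob L t i)"
        using 2 by (auto simp: blob_def)
      then have "(vtx i L, vtx i j) \<in> ?R"
        using 2 by (auto simp: adjacency_def flower_def)
      with path[of i L] 2 show ?thesis
        by (meson order_refl rtrancl.rtrancl_into_rtrancl)
    qed
  qed
qed

text \<open>Each path edge is a bridge: the only edge leaving the part of the \<open>i\<close>-th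
  arm from index \<open>j\<close> on. The condition \<open>j \<le> L\<close> keeps the whole
  negative clique on the far side.\<close>

lemma flower_cut_edge:
  assumes e: "{u, v} \<in> edges (flower L t s m)" and S: "u \<in> vtx i ` {j..}" "v \<notin> vtx i ` {j..}"
    and i: "i > 0" "j \<le> L"
  shows "{u, v} = path_edge i j"
proof -
  obtain a where a: "u = vtx i a" "j \<le> a"
    using S by auto
  consider "{u, v} \<in> pairs (core s)" | i' j' where "{u, v} = path_edge i' j'" "i' > 0"
    | i' where "{u, v} \<in> pairs (blob L t i')"
    using e by (auto simp: flower_def)
  then show ?thesis
  proof cases
    case 1
    with a i show ?thesis by (auto simp: core_def)
  next
    case 2
    with a i S have "i' = i \<and> j' = j"
      by (auto simp: path_edge_def doubleton_eq_iff split: if_splits)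
    with 2 show ?thesis by simp
  next
    case 3
    with a i S show ?thesis by (auto simp: blob_def)
  qed
qed

text \<open>Negative edges from a single clique number at most \<open>t choose 2\<close>, which is
  below \<open>k / 2\<close>. Meeting two cliques forces both paths into \<open>H\<close>, hence at
  least \<open>2 * (L + 1)\<close> positive edges, which is more than \<open>k / 2\<close>.\<close>

lemma local_positive_flower:
  assumes "k > 2 * (t choose 2)" "k < 4 * (L + 1)"
  shows "local_positive k (flower L t s m) (flower_weight L t m)"
  unfolding local_positive_def
proof (intro allI impI, elim conjE)
  let ?w = "flower_weight L t m"
  fix H assume H: "subgraph H (flower L t s m)" "connected_graph H" and k: "card (edges H) = k"
  have sH: "simple_graph H" and fin: "finite (edges H)" and sub: "edges H \<subseteq> edges (flower L t s m)"
    using H simple_graph_finite_edges by (auto simp: subgraph_def)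
  have negs: "negs ?w (edges H) \<subseteq> (\<Union>i\<in>{1..m}. pairs (blob L t i))"
    by (auto simp: negs_def flower_weight_def split: if_splits)
  have "2 * card (negs ?w (edges H)) < k"
  proof (cases "\<exists>i. negs ?w (edges H) \<subseteq> pairs (blob L t i)")
    case True
    then obtain i where "negs ?w (edges H) \<subseteq> pairs (blob L t i)" ..
    then have "card (negs ?w (edges H)) \<le> card (pairs (blob L t i))"
      by (intro card_mono finite_pairs) (auto simp: blob_def)
    also have "\<dots> = t choose 2"
      by (simp add: card_pairs blob_def card_image[OF inj_on_vtx])
    finally show ?thesis
      using assms by simp
  next
    case False
    then obtain e where e: "e \<in> negs ?w (edges H)"
      by blast
    with negs obtain i where i: "i \<in> {1..m}" "e \<in> pairs (blob L t i)"
      by blast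
    obtain e' where e': "e' \<in> negs ?w (edges H)" "e' \<notin> pairs (blob L t i)"
      using False by blast
    with negs obtain i' where i': "i' \<in> {1..m}" "e' \<in> pairs (blob L t i')"
      by blast
    then have "i \<noteq> i'"
      using e' by auto
    obtain x x' where x: "x \<in> verts H" "x \<in> blob L t i" "x' \<in> verts H" "x' \<in> blob L t i'"
    proof -
      have "e \<subseteq> verts H" "e' \<subseteq> verts H" "e \<noteq> {}" "e' \<noteq> {}"
        using e e' sH by (auto simp: negs_def simple_graph_def)
      then show thesis
        using that i i' unfolding pairs_def by blast
    qed
    \<comment> \<open>Every bridge on the path separates \<open>y\<close> from \<open>y'\<close>, so
      a connected \<open>H\<close> containing both must use it.\<close>
    have whole: "path_edge a j \<in> edges H"
      if "y \<in> verts H" "y \<in> blob L t a" "y' \<in> verts H" "y' \<in> blob L t a'" "a \<noteq> a'" "a > 0" "j \<le> L"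
      for a a' y y' j
    proof -
      have "y \<in> vtx a ` {j..}" "y' \<notin> vtx a ` {j..}"
        using that by (auto simp: blob_def)
      with that obtain u v where "{u, v} \<in> edges H" "u \<in> vtx a ` {j..}" "v \<notin> vtx a ` {j..}"
        using connected_graph_boundary_edge[OF H(2)] by metis
      then show ?thesis
        using flower_cut_edge[of u v L t s m a j] that sub by auto
    qed
    have paths: "(\<Union>a\<in>{i, i'}. path_edge a ` {..L}) \<subseteq> edges H - negs ?w (edges H)"
    proof -
      have "path_edge i j \<in> edges H" "path_edge i' j \<in> edges H" if "j \<le> L" for j
        using whole[of x i x' i' j] whole[of x' i' x i j] x i i' \<open>i \<noteq> i'\<close> that by auto
      moreover have "path_edge a j \<notin> negs ?w (edges H)" if "j \<le> L" "a > 0" for a j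
      proof
        assume "path_edge a j \<in> negs ?w (edges H)"
        with negs obtain b where "b \<in> {1..m}" "path_edge a j \<in> pairs (blob L t b)"
          by blast
        with path_edge_not_in_blob[of a b j L t] that show False
          by simp
      qed
      moreover have "i > 0" "i' > 0"
        using i i' by auto
      ultimately show ?thesis
        by blast
    qed
    have "2 * (L + 1) = card (\<Union>a\<in>{i, i'}. path_edge a ` {..L})"
      using card_path_edges[of "{i, i'}" L] i i' \<open>i \<noteq> i'\<close> by simp
    also have "\<dots> \<le> card (edges H - negs ?w (edges H))"
      using fin paths by (intro card_mono) auto
    also have "\<dots> = k - card (negs ?w (edges H))"
      using fin k by (subst card_Diff_subset) (auto simp: negs_def)
    finally show ?thesis
      using assms by linarith
  qed
  then show "weight ?w H > 0"
    using weight_eq_card_negs[OF weighing_flower fin, of L t m] k by simp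
qed

text \<open>With \<open>t = 4 * r\<close> a negative clique has exactly \<open>2 * L\<close> edges,
  so a clique with its path has weight \<open>- (L - 1)\<close>. The number 11 comes from the
  estimate for \<open>\<beta>\<close>, which needs
  \<open>3 * r * (8 - \<alpha>) > 32\<close>.\<close>

lemma collapses_avg_degree_family:
  fixes r :: nat
  assumes "\<alpha> < 8" and r: "real r * (8 - \<alpha>) > 11" "r > 0"
  shows "collapses (4 * (r * (4 * r - 1)) + 1) (avg_degree_family \<alpha>)"
proof (rule collapsesI)
  fix D :: nat
  define L where "L = r * (4 * r - 1)"
  define c where "c = L - 1"
  \<comment> \<open>The contribution of one path with its clique to twice the edge count minus
    \<open>\<alpha>\<close> times the vertex count. It must be positive so that many copies outweigh
    the loss from the positive clique's vertices and from \<open>D\<close>.\<close>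
  define \<beta> where "\<beta> = 8 * real L - \<alpha> * (real L + 4 * real r)"
  have t: "(4 * r) choose 2 = 2 * L"
    using r by (simp add: choose_two L_def)
  have Lr: "real L = real r * (4 * real r - 1)"
    using r by (simp add: L_def of_nat_diff)
  have "L \<ge> 1 * (4 * 1 - 1)"
    unfolding L_def using r by (intro mult_le_mono diff_le_mono) auto
  then have c: "c \<ge> 1" "L = c + 1"
    by (auto simp: c_def)
  have \<beta>: "\<beta> > 0"
  proof -
    have "real r * (3 * (real r * (8 - \<alpha>)) - 32) > 0"
      using r by simp
    \<comment> \<open>Since \<open>r \<ge> 1\<close>, \<open>L = 4 * r * r - r\<close> is at least
      \<open>3 * r * r\<close>.\<close>
    moreover have "(8 - \<alpha>) * real L \<ge> (8 - \<alpha>) * (3 * real r * real r)"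
      using assms(1) r unfolding Lr by (intro mult_left_mono) (auto simp: algebra_simps)
    moreover have "4 * real r * \<alpha> \<le> 32 * real r"
      using mult_left_mono[of \<alpha> 8 "4 * real r"] assms(1) by simp
    ultimately show ?thesis
      by (simp add: \<beta>_def algebra_simps)
  qed
  \<comment> \<open>The two terms will absorb \<open>2 * c * D\<close>, from the deficit in edges,
    and \<open>\<alpha> * s\<close>, which is at most \<open>16 * c * x\<close>.\<close>
  obtain x :: nat where x: "real x * \<beta> \<ge> 2 * real c * real D + 16 * real c" "x > 0"
  proof -
    obtain y :: nat where "(2 * real c * real D + 16 * real c) / \<beta> \<le> real y"
      using real_arch_simple by blast
    then have "real (Suc y) * \<beta> \<ge> 2 * real c * real D + 16 * real c"
      using \<beta> by (simp add: field_simps)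
    then show thesis
      using that by blast
  qed
  \<comment> \<open>\<open>s\<close> is a multiple of \<open>2 c\<close>, so that the weight becomes exactly \<open>- c D\<close>.\<close>
  define s where "s = 2 * c * x"
  define y where "y = x * (s - 1)"
  define m where "m = y + D"
  let ?G = "flower L (4 * r) s m" and ?w = "flower_weight L (4 * r) m"
  have pos: "s > 0" "4 * r > 0"
    using c x r by (auto simp: s_def)
  have s2: "s choose 2 = c * y"
    by (simp add: choose_two s_def y_def)
  have "weight ?w ?G = - int (c * D)"
    unfolding weight_flower[OF pos] t s2 using c(2) by (simp add: m_def algebra_simps)
  moreover have "D \<le> c * D"
    using c(1) by simp
  ultimately have "weight ?w ?G \<le> - int D"
    by linarith
  moreover have "local_positive (4 * L + 1) ?G ?w"
    by (rule local_positive_flower) (simp_all add: t)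
  moreover have "?G \<in> avg_degree_family \<alpha>"
  proof -
    \<comment> \<open>The number of arms grows quadratically in \<open>x\<close> but the positive
      clique has only linearly many vertices, so its effect on the average degree fades.\<close>
    have "x * x \<le> m"
    proof -
      have "x \<le> c * x"
        using c(1) by simp
      then have "x \<le> s - 1"
        using x(2) unfolding s_def by linarith
      then show ?thesis
        unfolding m_def y_def by (simp add: trans_le_add1)
    qed
    then have "real x * (real x * \<beta>) \<le> real m * \<beta>"
      using \<beta> by (metis mult.assoc mult_right_mono less_imp_le of_nat_le_iff of_nat_mult)
    moreover have "real x * (2 * real c * real D + 16 * real c) \<le> real x * (real x * \<beta>)"
      using x by (intro mult_left_mono) auto
    moreover have "2 * real c * real D + 2 * \<alpha> * real c * real x
        \<le> real x * (2 * real c * real D + 16 * real c)"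
    proof -
      have "1 * (2 * real c * real D) \<le> real x * (2 * real c * real D)"
        using x(2) by (intro mult_right_mono) auto
      moreover have "\<alpha> * (2 * real c * real x) \<le> 8 * (2 * real c * real x)"
        using assms(1) by (intro mult_right_mono) auto
      ultimately show ?thesis
        by (simp add: algebra_simps)
    qed
    ultimately have m\<beta>: "2 * real c * real D + 2 * \<alpha> * real c * real x \<le> real m * \<beta>"
      by linarith
    have "real (card (edges ?G)) = real c * real m - real c * real D + real m * (real L + 1) + real m * (2 * real L)"
      unfolding card_edges_flower t s2 by (simp add: m_def algebra_simps)
    also have "\<dots> = 4 * real m * real L - real c * real D"
      using c(2) by (simp add: algebra_simps)
    finally have e: "real (card (edges ?G)) = 4 * real m * real L - real c * real D" .
    have v: "real (card (verts ?G)) = 2 * real c * real x + real m * (real L + 4 * real r)"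
      by (simp add: card_verts_flower s_def)
    have "\<alpha> * real (card (verts ?G)) \<le> 2 * real (card (edges ?G))"
      unfolding e v using m\<beta> by (simp add: \<beta>_def algebra_simps)
    moreover have "card (verts ?G) > 0"
      using pos unfolding card_verts_flower by linarith
    ultimately have "average_degree ?G \<ge> \<alpha>"
      unfolding average_degree_eq[OF simple_graph_flower[OF pos]] by (simp add: pos_le_divide_eq)
    then show ?thesis
      using simple_graph_flower[OF pos] connected_flower[OF pos] by (simp add: avg_degree_family_def)
  qed
  ultimately show "\<exists>G\<in>avg_degree_family \<alpha>. \<exists>w. weighing G w \<and>
      local_positive (4 * (r * (4 * r - 1)) + 1) G w \<and> weight w G \<le> - int D"
    using weighing_flower unfolding L_def by blast
qed

theorem theorem1p3:
  shows "(\<forall>\<alpha>::real. \<alpha> < 8 \<longrightarrow> infinite {k::nat. k > 0 \<and> collapses k (avg_degree_family \<alpha>)}) \<and>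
         (\<forall>\<alpha>::real. \<alpha> \<ge> 8 \<longrightarrow> (\<forall>k::nat. k > 0 \<longrightarrow> forcing k (avg_degree_family \<alpha>)))"
proof (intro conjI allI impI)
  fix \<alpha> :: real assume \<alpha>: "\<alpha> < 8"
  obtain r0 :: nat where "11 / (8 - \<alpha>) < real r0"
    using reals_Archimedean2 by blast
  then have r0: "11 < real r0 * (8 - \<alpha>)"
    using \<alpha> by (simp add: field_simps)
  show "infinite {k::nat. k > 0 \<and> collapses k (avg_degree_family \<alpha>)}"
    unfolding infinite_nat_iff_unbounded_le
  proof
    fix n :: nat
    \<comment> \<open>The summand \<open>r0\<close> preserves the requirement on
      \<open>r * (8 - \<alpha>)\<close>, and \<open>n\<close> pushes the resulting \<open>k\<close>
      beyond \<open>n\<close>.\<close>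
    define r where "r = r0 + n + 1"
    have "real r0 * (8 - \<alpha>) \<le> real r * (8 - \<alpha>)"
      using \<alpha> by (intro mult_right_mono) (auto simp: r_def)
    with r0 have "real r * (8 - \<alpha>) > 11"
      by linarith
    then have "collapses (4 * (r * (4 * r - 1)) + 1) (avg_degree_family \<alpha>)"
      by (rule collapses_avg_degree_family[OF \<alpha>]) (simp add: r_def)
    moreover have "r * 1 \<le> r * (4 * r - 1)"
      by (intro mult_left_mono) (auto simp: r_def)
    then have "n \<le> 4 * (r * (4 * r - 1)) + 1"
      by (simp add: r_def)
    ultimately show "\<exists>k\<ge>n. k \<in> {k. k > 0 \<and> collapses k (avg_degree_family \<alpha>)}"
      by (intro exI[of _ "4 * (r * (4 * r - 1)) + 1"]) simp
  qed
qed (rule forcing_avg_degree_family)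

end
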